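(* Let $\{u^j\}_{j\in\mathbb{N}}$ be a sequence generated by PGN converging to a P-stationary point $\widehat u=(\widehat w,\widehat\xi)$ of $\min_u G(u)$. Suppose that the strict complementarity condition $$\widehat\xi_i+[\nabla_\xi g(\widehat u)]_i\neq 0\qquad\text{for all } i\in[m]$$ holds. Then there exists a sufficiently large integer $j_k$ such that the Newton step is accepted (i.e. $u^{j+1}=\widetilde u^{j+1}$) for all iterations $j\ge j_k$. Moreover, $$\|u^{j+1}-\widehat u\|\le O(\|u^j-\widehat u\|^2)\qquad\text{for } j\ge j_k,$$ i.e. there is a constant $C$ with $\|u^{j+1}-\widehat u\|\le C\|u^j-\widehat u\|^2$ for all $j\ge j_k$.
   Context: Setting: $m,n,s$ are positive integers with $s\le n$, $\lambda,\rho,\mu>0$, and $A\in\mathbb{R}^{m\times n}$ is the data matrix whose $i$-th row is $-y_i[x_i^\top,1]$, with $x_i\in\mathbb{R}^{n-1}$, $y_i\in\{1,-1\}$. $\mathbf 1$ is the all-ones vector; $\|w\|_0$ is the number of nonzero entries of $w$; $\mathbb{S}:=\{w\in\mathbb{R}^n:\|w\|_0\le s\}$ with indicator function $\delta_{\mathbb{S}}$. $J(\xi):=\sum_{i=1}^m h(\xi_i)$, with $h(t)=1$ if $t>0$, $h(t)=0$ if $t\le0$. $u=(w,\xi)\in\mathbb{R}^{n+m}$. For an index set $T$, $\overline T$ is its complement and $w_T$ the subvector. $\mathrm{Proj}_{\mathbb{S}}(w)$ is the set of Euclidean nearest points of $\mathbb{S}$ to $w$; $\mathrm{Prox}_{\beta\lambda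 J(\cdot)}(\xi):=\arg\min_{q}\{\lambda J(q)+\frac1{2\beta}\|q-\xi\|^2\}$. $\mathcal T_s(w)$ is the collection of all sets of $s$ indices giving the $s$ largest entries of $|w|$ in absolute value. Subproblem: for fixed $z^k\in\mathbb{R}^m$, $w^k\in\mathbb{R}^n$, let $g(u):=\frac12\|w\|^2+\langle z^k,Aw+\mathbf 1-\xi\rangle+\frac\rho2\|Aw+\mathbf 1-\xi\|^2+\frac\mu2\|w-w^k\|^2$ and $G(u):=g(u)+\delta_{\mathbb{S}}(w)+\lambda J(\xi)$. $\nabla g$ is Lipschitz on $\mathbb{R}^{n+m}$ with constant $\ell_g>0$ and $g$ is strongly convex with constant $\sigma_g>0$. Algorithm PGN: fix $\alpha,\beta\in(0,1/\ell_g)$ and $u^0=(w^0,\xi^0)$ with $\|w^0\|_0\le s$. For $j=0,1,\dots$: 1. $\widehat w^j=w^j-\alpha\nabla_w g(u^j)$, $\widehat\xi^j=\xi^j-\beta\nabla_\xi g(u^j)$; choose $T_j\in\mathcal T_s(\widehat w^j)$ and set $\Gamma_j=\{i\in[m]:[\widehat\xi^j]_i\in(-\infty,0)\cup(\sqrt{2\lambda\beta},\infty)\}$. 2. Gradient step $u^{j+1/2}=(w^{j+1/2},\xi^{j+1/2})$: $w^{j+1/2}_i=\widehat w^j_i$ for $i\in T_j$ and $0$ otherwise; $\xi^{j+1/2}_i=\widehat\xi^j_i$ for $i\in\Gamma_j$ and $0$ otherwise. 3. Newton step: let $\Upsilon_j$ be the set of coordinates of $u$ consisting of the $w$-coordinates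 in $T_j$ and the $\xi$-coordinates in $\Gamma_j$. $\widetilde u^{j+1}$ is the solution $u=(w,\xi)$ of $[\nabla^2 g(u^{j+1/2})]_{\Upsilon_j,\Upsilon_j}(u-u^{j+1/2})_{\Upsilon_j}=-[\nabla g(u^{j+1/2})]_{\Upsilon_j}$, $w_{\overline T_j}=0$, $\xi_{\overline\Gamma_j}=0$. 4. $u^{j+1}=\widetilde u^{j+1}$ (Newton step accepted) if $G(u^{j+1/2})-G(\widetilde u^{j+1})\ge\frac{\sigma_g}4\|u^{j+1/2}-\widetilde u^{j+1}\|^2$; otherwise $u^{j+1}=u^{j+1/2}$. P-stationary point of $\min_u G(u)$: $\widehat u=(\widehat w,\widehat\xi)$ with $\widehat w\in\mathrm{Proj}_{\mathbb{S}}(\widehat w-\alpha\nabla_w g(\widehat u))$ and $\widehat\xi\in\mathrm{Prox}_{\beta\lambda J(\cdot)}(\widehat\xi-\beta\nabla_\xi g(\widehat u))$, with the $\alpha,\beta$ of PGN. *)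

theory Defs
  imports "HOL-Analysis.Analysis"
begin

definition grad :: "('a::real_inner \<Rightarrow> real) \<Rightarrow> 'a \<Rightarrow> 'a" where
  "grad f x = (THE D. GDERIV f x :> D)"

lemma grad_eqI:
  assumes "GDERIV f x :> D"
  shows "grad f x = D"
  unfolding grad_def
proof (rule the_equality)
  fix E assume "GDERIV f x :> E"
  with assms have "(\<lambda>h. inner h D) = (\<lambda>h. inner h E)"
    unfolding gderiv_def by (rule has_derivative_unique)
  then have "\<And>h. inner h (E - D) = 0"
    by (metis inner_diff_right right_minus_eq)
  then have "inner (E - D) (E - D) = 0" by blast
  then show "E = D" by simp
qed (rule assms)

text \<open>Entry of the Hessian matrix in row \<open>a\<close> and column \<open>b\<close>, where \<open>a\<close> and \<open>b\<close> are
  elements of the canonical basis.\<close>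

definition hess :: "('a::euclidean_space \<Rightarrow> real) \<Rightarrow> 'a \<Rightarrow> 'a \<Rightarrow> 'a \<Rightarrow> real" where
  "hess f x a b = inner (frechet_derivative (grad f) (at x) b) a"

definition strongly_convex :: "real \<Rightarrow> ('a::real_inner \<Rightarrow> real) \<Rightarrow> bool" where
  "strongly_convex \<sigma> f \<longleftrightarrow>
    (\<forall>x y. \<forall>t\<in>{0..1}. f ((1 - t) *\<^sub>R x + t *\<^sub>R y)
        \<le> (1 - t) * f x + t * f y - \<sigma> / 2 * t * (1 - t) * (norm (x - y))\<^sup>2)"

definition l0norm :: "real ^ 'n \<Rightarrow> nat" where
  "l0norm w = card {i. w $ i \<noteq> 0}"

definition sparse_set :: "nat \<Rightarrow> (real ^ 'n) set" where
  "sparse_set s = {w. l0norm w \<le> s}"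

definition step_loss :: "real ^ 'm \<Rightarrow> real" where
  "step_loss \<xi> = (\<Sum>i\<in>UNIV. if \<xi> $ i > 0 then 1 else 0)"

definition proj_set :: "'a::metric_space set \<Rightarrow> 'a \<Rightarrow> 'a set" where
  "proj_set S x = {v. is_arg_min (\<lambda>v. dist v x) (\<lambda>v. v \<in> S) v}"

text \<open>The operator for parameter \<open>\<beta>\<close> and function \<open>f\<close>, usually written with subscript \<open>\<beta> f\<close>.\<close>

definition prox :: "real \<Rightarrow> ('a::real_normed_vector \<Rightarrow> real) \<Rightarrow> 'a \<Rightarrow> 'a set" where
  "prox \<beta> f x = {q. is_arg_min (\<lambda>q. f q + 1 / (2 * \<beta>) * (norm (q - x))\<^sup>2) (\<lambda>_. True) q}"

definition top_index_sets :: "nat \<Rightarrow> real ^ 'n \<Rightarrow> 'n set set" where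
  "top_index_sets s w = {T. card T = s \<and> (\<forall>i\<in>T. \<forall>j\<in>- T. \<bar>w $ j\<bar> \<le> \<bar>w $ i\<bar>)}"

text \<open>The finite index type \<open>'n\<close> plays the role of \<open>{1..n}\<close> and \<open>b\<close> that of the last index, which
  carries the bias. The feature vectors have \<open>n - 1\<close> entries, indexed by \<open>'n\<close> without \<open>b\<close>;
  coordinate \<open>b\<close> of \<open>x $ i\<close> is never read. This also covers \<open>n = 1\<close>.\<close>

definition data_matrix :: "'n \<Rightarrow> real ^ 'n ^ 'm \<Rightarrow> real ^ 'm \<Rightarrow> real ^ 'n ^ 'm" where
  "data_matrix b x y = (\<chi> i j. - (y $ i) * (if j = b then 1 else x $ i $ j))"

text \<open>In the next definition, \<open>1\<close> in the vector space is the all-ones vector.\<close>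

definition sub_g ::
    "real ^ 'n ^ 'm \<Rightarrow> real \<Rightarrow> real \<Rightarrow> real ^ 'm \<Rightarrow> real ^ 'n \<Rightarrow> (real ^ 'n) \<times> (real ^ 'm) \<Rightarrow> real" where
  "sub_g A \<rho> \<mu> z wk = (\<lambda>(w, \<xi>).
      1 / 2 * (norm w)\<^sup>2 + inner z (A *v w + 1 - \<xi>)
      + \<rho> / 2 * (norm (A *v w + 1 - \<xi>))\<^sup>2 + \<mu> / 2 * (norm (w - wk))\<^sup>2)"

definition indicator_ext :: "'a set \<Rightarrow> 'a \<Rightarrow> ereal" where
  "indicator_ext S x = (if x \<in> S then 0 else \<infinity>)"

definition obj ::
    "((real ^ 'n) \<times> (real ^ 'm) \<Rightarrow> real) \<Rightarrow> nat \<Rightarrow> real \<Rightarrow> (real ^ 'n) \<times> (real ^ 'm) \<Rightarrow> ereal" where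
  "obj g s lam u =
      ereal (g u) + indicator_ext (sparse_set s) (fst u) + ereal (lam * step_loss (snd u))"

definition P_stationary ::
    "((real ^ 'n) \<times> (real ^ 'm) \<Rightarrow> real) \<Rightarrow> nat \<Rightarrow> real \<Rightarrow> real \<Rightarrow> real
      \<Rightarrow> (real ^ 'n) \<times> (real ^ 'm) \<Rightarrow> bool" where
  "P_stationary g s lam \<alpha> \<beta> u \<longleftrightarrow>
      fst u \<in> proj_set (sparse_set s) (fst u - \<alpha> *\<^sub>R fst (grad g u)) \<and>
      snd u \<in> prox \<beta> (\<lambda>q. lam * step_loss q) (snd u - \<beta> *\<^sub>R snd (grad g u))"

definition vec_restrict :: "'n set \<Rightarrow> real ^ 'n \<Rightarrow> real ^ 'n" where
  "vec_restrict T w = (\<chi> i. if i \<in> T then w $ i else 0)"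

text \<open>A set of coordinates of \<open>u = (w, \<xi>)\<close> is represented by the corresponding elements of the
  canonical basis of the product space.\<close>

definition coords :: "'n set \<Rightarrow> 'm set \<Rightarrow> ((real ^ 'n) \<times> (real ^ 'm)) set" where
  "coords T \<Gamma> = (\<lambda>i. (axis i 1, 0)) ` T \<union> (\<lambda>i. (0, axis i 1)) ` \<Gamma>"

definition newton_solution ::
    "((real ^ 'n) \<times> (real ^ 'm) \<Rightarrow> real) \<Rightarrow> 'n set \<Rightarrow> 'm set
      \<Rightarrow> (real ^ 'n) \<times> (real ^ 'm) \<Rightarrow> (real ^ 'n) \<times> (real ^ 'm) \<Rightarrow> bool" where
  "newton_solution g T \<Gamma> v u \<longleftrightarrow>
      (\<forall>a\<in>coords T \<Gamma>. (\<Sum>b\<in>coords T \<Gamma>. hess g v a b * inner (u - v) b) = - inner (grad g v) a) \<and>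
      (\<forall>i. i \<notin> T \<longrightarrow> fst u $ i = 0) \<and>
      (\<forall>i. i \<notin> \<Gamma> \<longrightarrow> snd u $ i = 0)"

definition newton_accepted ::
    "((real ^ 'n) \<times> (real ^ 'm) \<Rightarrow> real) \<Rightarrow> nat \<Rightarrow> real \<Rightarrow> real
      \<Rightarrow> (real ^ 'n) \<times> (real ^ 'm) \<Rightarrow> (real ^ 'n) \<times> (real ^ 'm) \<Rightarrow> bool" where
  "newton_accepted g s lam \<sigma> uh ut \<longleftrightarrow>
      obj g s lam uh - obj g s lam ut \<ge> ereal (\<sigma> / 4 * (norm (uh - ut))\<^sup>2)"

text \<open>One iteration from \<open>u\<close> to \<open>u'\<close>, with index choices \<open>T\<close> and \<open>\<Gamma>\<close>, half step \<open>uh\<close> and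
  Newton point \<open>ut\<close>.\<close>

definition pgn_step ::
    "((real ^ 'n) \<times> (real ^ 'm) \<Rightarrow> real) \<Rightarrow> nat \<Rightarrow> real \<Rightarrow> real \<Rightarrow> real \<Rightarrow> real
      \<Rightarrow> (real ^ 'n) \<times> (real ^ 'm) \<Rightarrow> 'n set \<Rightarrow> 'm set
      \<Rightarrow> (real ^ 'n) \<times> (real ^ 'm) \<Rightarrow> (real ^ 'n) \<times> (real ^ 'm) \<Rightarrow> (real ^ 'n) \<times> (real ^ 'm) \<Rightarrow> bool" where
  "pgn_step g s lam \<alpha> \<beta> \<sigma> u T \<Gamma> uh ut u' \<longleftrightarrow>
    (let wg = fst u - \<alpha> *\<^sub>R fst (grad g u);
         \<xi>g = snd u - \<beta> *\<^sub>R snd (grad g u)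
     in T \<in> top_index_sets s wg \<and>
        \<Gamma> = {i. \<xi>g $ i < 0 \<or> \<xi>g $ i > sqrt (2 * lam * \<beta>)} \<and>
        uh = (vec_restrict T wg, vec_restrict \<Gamma> \<xi>g) \<and>
        newton_solution g T \<Gamma> uh ut \<and>
        u' = (if newton_accepted g s lam \<sigma> uh ut then ut else uh))"

definition pgn_run ::
    "((real ^ 'n) \<times> (real ^ 'm) \<Rightarrow> real) \<Rightarrow> nat \<Rightarrow> real \<Rightarrow> real \<Rightarrow> real \<Rightarrow> real
      \<Rightarrow> (nat \<Rightarrow> (real ^ 'n) \<times> (real ^ 'm)) \<Rightarrow> (nat \<Rightarrow> 'n set) \<Rightarrow> (nat \<Rightarrow> 'm set)
      \<Rightarrow> (nat \<Rightarrow> (real ^ 'n) \<times> (real ^ 'm)) \<Rightarrow> (nat \<Rightarrow> (real ^ 'n) \<times> (real ^ 'm)) \<Rightarrow> bool" where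
  "pgn_run g s lam \<alpha> \<beta> \<sigma> u T \<Gamma> uh ut \<longleftrightarrow>
      l0norm (fst (u 0)) \<le> s \<and>
      (\<forall>j. pgn_step g s lam \<alpha> \<beta> \<sigma> (u j) (T j) (\<Gamma> j) (uh j) (ut j) (u (Suc j)))"

end

theory Submission
  imports Defs
begin

text \<open>
  The smooth part \<open>g\<close> is a strongly convex quadratic, so the Newton equation on the selected
  coordinates is solved by the unique minimiser of \<open>g\<close> on the corresponding coordinate subspace
  (\<open>newton_solution_grad_zero\<close>, \<open>coord_space_critical_unique\<close>). Quadratic convergence is
  therefore obtained in its strongest form: from some iteration on, the Newton point
  \<^emph>\<open>equals\<close> the limit \<open>uhat\<close>, because \<open>uhat\<close> is that minimiser.

  To see this, two facts are needed for all late iterations: \<open>uhat\<close> vanishes on the coordinates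
  that are not selected, and the gradient of \<open>g\<close> at \<open>uhat\<close> vanishes on those that are. Both
  follow from the convergence of the iterates, whichever candidate becomes the next iterate
  (\<open>selection_identified\<close>). If a coordinate is not selected, the next iterate is zero there.
  If it is selected, then either the next iterate differs from the current one by a gradient
  step, whose length must tend to zero, or the gradient at the next iterate vanishes there.
  As there are finitely many coordinates, the persistent possibilities pass to the limit.

  The same two facts make the \<open>\<xi>\<close>-part of the half steps converge to that of \<open>uhat\<close>
  (\<open>gradient_step_tendsto\<close>). For acceptance, strong convexity gives a decrease of \<open>g\<close> by at
  least \<open>\<sigma>g / 2\<close> times the squared length of the step, twice what is required; the step loss is lower semicontinuous and takes finitely many values, so it is
  eventually at least as large at the half steps as at their limit (\<open>step_loss_lsc\<close>).
\<close>

section \<open>Quadratic functions\<close>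

locale quadratic =
  fixes f :: "'a::euclidean_space \<Rightarrow> real" and L :: "'a \<Rightarrow> 'a" and c :: 'a
  assumes linear_L: "linear L"
    and symmetric_L: "inner (L x) y = inner x (L y)"
    and f_eq: "f x = f 0 + inner c x + inner (L x) x / 2"
begin

lemma bounded_linear_L: "bounded_linear L"
  using linear_L by (rule linear_conv_bounded_linear[THEN iffD1])

lemma grad_eq: "grad f x = c + L x"
proof (rule grad_eqI)
  have "((\<lambda>x. f 0 + inner c x + inner (L x) x / 2) has_derivative
      (\<lambda>h. inner c h + (inner (L x) h + inner (L h) x) / 2)) (at x)"
    by (auto intro!: derivative_eq_intros bounded_linear.has_derivative[OF bounded_linear_L])
  moreover have "(\<lambda>h. inner c h + (inner (L x) h + inner (L h) x) / 2) = (\<lambda>h. inner h (c + L x))"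
  proof
    fix h
    have "inner (L h) x = inner h (L x)"
      by (rule symmetric_L)
    then show "inner c h + (inner (L x) h + inner (L h) x) / 2 = inner h (c + L x)"
      by (simp add: inner_add inner_commute)
  qed
  ultimately show "GDERIV f x :> c + L x"
    unfolding gderiv_def by (simp flip: f_eq)
qed

lemma grad_diff: "grad f x - grad f y = L (x - y)"
  by (simp add: grad_eq linear_diff[OF linear_L])

lemma hess_eq: "hess f x a b = inner (L b) a"
proof -
  have "((\<lambda>x. c + L x) has_derivative L) (at x)"
    by (auto intro!: derivative_eq_intros bounded_linear.has_derivative[OF bounded_linear_L])
  then have "frechet_derivative (grad f) (at x) = L"
    using frechet_derivative_at by (metis (no_types, lifting) ext grad_eq)
  then show ?thesis
    by (simp add: hess_def)
qed

lemma taylor: "f y = f x + inner (grad f x) (y - x) + inner (L (y - x)) (y - x) / 2"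
proof -
  have "f y = f 0 + inner c y + inner (L y) y / 2" "f x = f 0 + inner c x + inner (L x) x / 2"
    by (rule f_eq)+
  moreover have "inner (L x) y = inner (L y) x"
    by (metis symmetric_L inner_commute)
  ultimately show ?thesis
    by (simp add: grad_eq linear_diff[OF linear_L] inner_diff inner_add field_simps)
qed

lemma strongly_convex_coercive:
  assumes "strongly_convex \<sigma> f"
  shows "\<sigma> * (norm h)\<^sup>2 \<le> inner (L h) h"
proof -
  have half: "(1 / 2 :: real) \<in> {0..1}"
    by simp
  have "f ((1 - 1/2) *\<^sub>R 0 + (1/2) *\<^sub>R h)
      \<le> (1 - 1/2) * f 0 + 1/2 * f h - \<sigma> / 2 * (1/2) * (1 - 1/2) * (norm (0 - h))\<^sup>2"
    using assms half unfolding strongly_convex_def by blast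
  then have "f ((1/2) *\<^sub>R h) \<le> f 0 / 2 + f h / 2 - \<sigma> * (norm h)\<^sup>2 / 8"
    by simp
  moreover have "f h = f 0 + inner c h + inner (L h) h / 2"
    by (rule f_eq)
  moreover have "f ((1/2) *\<^sub>R h) = f 0 + inner c h / 2 + inner (L h) h / 8"
    using f_eq[of "(1/2) *\<^sub>R h"] by (simp add: linear_cmul[OF linear_L])
  ultimately show ?thesis
    by argo
qed

end

text \<open>The linear part is read off by expanding \<open>g\<close> around the origin; the Hessian is
  that of \<open>(1 + \<mu>) / 2 * (norm w)\<^sup>2 + \<rho> / 2 * (norm (A *v w - \<xi>))\<^sup>2\<close>.\<close>

lemma quadratic_sub_g:
  "quadratic (sub_g A \<rho> \<mu> z wk)
     (\<lambda>(w, \<xi>). ((1 + \<mu>) *\<^sub>R w + \<rho> *\<^sub>R (transpose A *v (A *v w - \<xi>)), - \<rho> *\<^sub>R (A *v w - \<xi>)))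
     (transpose A *v (z + \<rho> *\<^sub>R 1) - \<mu> *\<^sub>R wk, - (z + \<rho> *\<^sub>R 1))"
    (is "quadratic _ ?L ?c")
proof (rule quadratic.intro)
  show "linear ?L"
    by (rule linearI) (auto simp: algebra_simps matrix_vector_right_distrib
        matrix_vector_mult_diff_distrib matrix_vector_mult_scaleR simp del: transpose_matrix_vector)
  have adj: "inner (transpose A *v a) b = inner a (A *v b)" for a b
    by (metis dot_lmul_matrix transpose_matrix_vector)
  have adj': "inner b (transpose A *v a) = inner (A *v b) a" for a b
    by (metis adj inner_commute)
  show "inner (?L p) q = inner p (?L q)" for p q
    by (cases p; cases q) (simp add: inner_add inner_diff inner_commute adj adj' algebra_simps
        del: transpose_matrix_vector)
  show "sub_g A \<rho> \<mu> z wk p = sub_g A \<rho> \<mu> z wk 0 + inner ?c p + inner (?L p) p / 2" for p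
    by (cases p) (simp add: sub_g_def power2_norm_eq_inner inner_add inner_diff adj adj'
        inner_commute zero_prod_def field_simps del: transpose_matrix_vector)
qed

section \<open>Coordinate subspaces and the Newton equation\<close>

definition coord_space :: "'n set \<Rightarrow> 'm set \<Rightarrow> ((real ^ 'n) \<times> (real ^ 'm)) set" where
  "coord_space T \<Gamma> = {v. (\<forall>i. i \<notin> T \<longrightarrow> fst v $ i = 0) \<and> (\<forall>i. i \<notin> \<Gamma> \<longrightarrow> snd v $ i = 0)}"

lemma coord_space_diff:
  "u \<in> coord_space T \<Gamma> \<Longrightarrow> v \<in> coord_space T \<Gamma> \<Longrightarrow> u - v \<in> coord_space T \<Gamma>"
  by (simp add: coord_space_def)

lemma coord_space_expansion:
  fixes v :: "(real ^ 'n::finite) \<times> (real ^ 'm::finite)"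
  assumes "v \<in> coord_space T \<Gamma>"
  shows "(\<Sum>b\<in>coords T \<Gamma>. inner v b *\<^sub>R b) = v"
proof -
  have "(\<Sum>b\<in>coords T \<Gamma>. inner v b *\<^sub>R b) = (\<Sum>b\<in>Basis. inner v b *\<^sub>R b)"
  proof (rule sum.mono_neutral_left)
    show "coords T \<Gamma> \<subseteq> (Basis :: ((real ^ 'n) \<times> (real ^ 'm)) set)"
      by (auto simp: coords_def Basis_prod_def Basis_vec_def)
    show "\<forall>b\<in>Basis - coords T \<Gamma>. inner v b *\<^sub>R b = 0"
      using assms
      by (cases v) (auto simp: coords_def Basis_prod_def Basis_vec_def coord_space_def inner_axis)
  qed simp
  then show ?thesis
    by (simp add: euclidean_representation)
qed

lemma orthogonal_coord_space:
  fixes d v :: "(real ^ 'n::finite) \<times> (real ^ 'm::finite)"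
  assumes "\<And>i. i \<in> T \<Longrightarrow> fst d $ i = 0" and "\<And>i. i \<in> \<Gamma> \<Longrightarrow> snd d $ i = 0"
    and "v \<in> coord_space T \<Gamma>"
  shows "inner d v = 0"
proof -
  have "inner (fst d) (fst v) = 0" "inner (snd d) (snd v) = 0"
    using assms unfolding inner_vec_def coord_space_def
    by (fastforce intro!: sum.neutral)+
  then show ?thesis
    by (simp add: inner_prod_def)
qed

lemma newton_solution_coord_space: "newton_solution g T \<Gamma> v u \<Longrightarrow> u \<in> coord_space T \<Gamma>"
  by (simp add: newton_solution_def coord_space_def)

text \<open>The step \<open>u - v\<close> lies in the coordinate subspace, so the partial Hessian applied to it
  is the full Hessian applied to it, restricted to the selected rows. Since \<open>g\<close> is quadratic, that is
  the exact gradient difference, and the Newton equation says that the new gradient vanishes on the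
  selected coordinates.\<close>

lemma newton_solution_grad_zero:
  fixes g :: "(real ^ 'n::finite) \<times> (real ^ 'm::finite) \<Rightarrow> real"
  assumes "quadratic g L c" and "newton_solution g T \<Gamma> v u" and "v \<in> coord_space T \<Gamma>"
  shows "i \<in> T \<Longrightarrow> fst (grad g u) $ i = 0" and "k \<in> \<Gamma> \<Longrightarrow> snd (grad g u) $ k = 0"
proof -
  interpret quadratic g L c by fact
  have uv: "u - v \<in> coord_space T \<Gamma>"
    using assms newton_solution_coord_space coord_space_diff by blast
  have zero: "inner (grad g u) a = 0" if "a \<in> coords T \<Gamma>" for a
  proof -
    have "L (u - v) = (\<Sum>b\<in>coords T \<Gamma>. inner (u - v) b *\<^sub>R L b)"
      by (metis (no_types, lifting) coord_space_expansion[OF uv] linear_sum[OF linear_L]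
          linear_cmul[OF linear_L] sum.cong)
    then have "inner (L (u - v)) a = (\<Sum>b\<in>coords T \<Gamma>. hess g v a b * inner (u - v) b)"
      by (simp add: inner_sum_left hess_eq mult.commute)
    also have "\<dots> = - inner (grad g v) a"
      using assms(2) that by (simp add: newton_solution_def)
    finally show ?thesis
      by (simp flip: grad_diff add: inner_diff)
  qed
  show "fst (grad g u) $ i = 0" if "i \<in> T"
    using zero[of "(axis i 1, 0)"] that by (simp add: coords_def inner_prod_def inner_axis)
  show "snd (grad g u) $ k = 0" if "k \<in> \<Gamma>"
    using zero[of "(0, axis k 1)"] that by (simp add: coords_def inner_prod_def inner_axis)
qed

text \<open>A gradient that vanishes on the selected coordinates is orthogonal to \<open>u - v\<close>. If this holds
  at both points, the curvature of \<open>g\<close> along \<open>u - v\<close> is zero, which coercivity excludes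
  unless \<open>u = v\<close>.\<close>

lemma coord_space_critical_unique:
  fixes g :: "(real ^ 'n::finite) \<times> (real ^ 'm::finite) \<Rightarrow> real"
  assumes "quadratic g L c" and "strongly_convex \<sigma> g" and "\<sigma> > 0"
    and "u \<in> coord_space T \<Gamma>"
    and "\<And>i. i \<in> T \<Longrightarrow> fst (grad g u) $ i = 0" and "\<And>i. i \<in> \<Gamma> \<Longrightarrow> snd (grad g u) $ i = 0"
    and "v \<in> coord_space T \<Gamma>"
    and "\<And>i. i \<in> T \<Longrightarrow> fst (grad g v) $ i = 0" and "\<And>i. i \<in> \<Gamma> \<Longrightarrow> snd (grad g v) $ i = 0"
  shows "u = v"
proof -
  interpret quadratic g L c by fact
  have "inner (L (u - v)) (u - v) = 0"
    unfolding grad_diff[symmetric]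
    by (rule orthogonal_coord_space[of T _ \<Gamma>]) (simp_all add: assms coord_space_diff)
  then have "\<sigma> * (norm (u - v))\<^sup>2 \<le> 0"
    using strongly_convex_coercive[OF assms(2), of "u - v"] by simp
  then show ?thesis
    using \<open>\<sigma> > 0\<close> by (simp add: mult_le_0_iff)
qed

lemma coord_space_quadratic_growth:
  fixes g :: "(real ^ 'n::finite) \<times> (real ^ 'm::finite) \<Rightarrow> real"
  assumes "quadratic g L c" and "strongly_convex \<sigma> g"
    and "u \<in> coord_space T \<Gamma>"
    and "\<And>i. i \<in> T \<Longrightarrow> fst (grad g u) $ i = 0" and "\<And>i. i \<in> \<Gamma> \<Longrightarrow> snd (grad g u) $ i = 0"
    and "v \<in> coord_space T \<Gamma>"
  shows "g u + \<sigma> / 2 * (norm (v - u))\<^sup>2 \<le> g v"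
proof -
  interpret quadratic g L c by fact
  have "inner (grad g u) (v - u) = 0"
    by (rule orthogonal_coord_space[of T _ \<Gamma>]) (simp_all add: assms coord_space_diff)
  then show ?thesis
    using taylor[of v u] strongly_convex_coercive[OF assms(2), of "v - u"] by simp
qed

section \<open>Sparsity and the step loss\<close>

lemma coord_space_sparse:
  fixes v :: "(real ^ 'n::finite) \<times> (real ^ 'm::finite)"
  assumes "v \<in> coord_space T \<Gamma>" and "card T = s"
  shows "fst v \<in> sparse_set s"
proof -
  have "{i. fst v $ i \<noteq> 0} \<subseteq> T"
    using assms(1) by (auto simp: coord_space_def)
  then show ?thesis
    using assms(2) card_mono[OF finite[of T]] by (auto simp: sparse_set_def l0norm_def)
qed

text \<open>Strictly positive entries of the limit are eventually positive along the sequence, while the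
  other entries contribute nothing to the loss of the limit.\<close>

lemma step_loss_lsc:
  assumes "X \<longlonglongrightarrow> \<xi>"
  shows "\<forall>\<^sub>F j in sequentially. step_loss \<xi> \<le> step_loss (X j)"
proof -
  have "\<forall>\<^sub>F j in sequentially. \<xi> $ i > 0 \<longrightarrow> X j $ i > 0" for i
    using order_tendstoD(1)[OF tendsto_vec_nth[OF assms], of 0 i] by (cases "\<xi> $ i > 0") auto
  then have "\<forall>\<^sub>F j in sequentially. \<forall>i. \<xi> $ i > 0 \<longrightarrow> X j $ i > 0"
    by (rule eventually_all_finite)
  then show ?thesis
    by eventually_elim (auto simp: step_loss_def intro!: sum_mono)
qed

section \<open>Identification of the active coordinates\<close>

text \<open>The behaviour of one coordinate along the algorithm: \<open>u j\<close> is its value, \<open>d j\<close> the partial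
  derivative of \<open>g\<close> and \<open>S j\<close> says that it is selected. In \<open>sel\<close>, the first alternative is an
  iteration that keeps the half step, the second one that takes the Newton point.
  If \<open>d\<^sub>0 \<noteq> 0\<close>, a gradient step moves the coordinate by about \<open>\<gamma> * \<bar>d\<^sub>0\<bar>\<close>, which a convergent
  sequence can do only finitely often, and \<open>d (Suc j) = 0\<close> also occurs only finitely often.\<close>

lemma selection_identified:
  fixes u d :: "nat \<Rightarrow> real"
  assumes "u \<longlonglongrightarrow> u\<^sub>0" and "d \<longlonglongrightarrow> d\<^sub>0" and "\<gamma> > 0"
    and sel: "\<And>j. S j \<Longrightarrow> u (Suc j) = u j - \<gamma> * d j \<or> d (Suc j) = 0"
    and unsel: "\<And>j. \<not> S j \<Longrightarrow> u (Suc j) = 0"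
  shows "\<forall>\<^sub>F j in sequentially. if S j then d\<^sub>0 = 0 else u\<^sub>0 = 0"
proof -
  have "\<forall>\<^sub>F j in sequentially. S j \<longrightarrow> d\<^sub>0 = 0"
  proof (cases "d\<^sub>0 = 0")
    case False
    have "(\<lambda>j. u (Suc j) - (u j - \<gamma> * d j)) \<longlonglongrightarrow> u\<^sub>0 - (u\<^sub>0 - \<gamma> * d\<^sub>0)"
      by (intro tendsto_intros assms LIMSEQ_Suc)
    then have "\<forall>\<^sub>F j in sequentially. u (Suc j) - (u j - \<gamma> * d j) \<noteq> 0"
      by (rule tendsto_imp_eventually_ne) (use False \<open>\<gamma> > 0\<close> in simp)
    moreover have "\<forall>\<^sub>F j in sequentially. d (Suc j) \<noteq> 0"
      by (rule tendsto_imp_eventually_ne[OF LIMSEQ_Suc[OF assms(2)] False])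
    ultimately show ?thesis
      by eventually_elim (use sel in auto)
  qed simp
  moreover have "\<forall>\<^sub>F j in sequentially. \<not> S j \<longrightarrow> u\<^sub>0 = 0"
  proof (cases "u\<^sub>0 = 0")
    case False
    then have "\<forall>\<^sub>F j in sequentially. u (Suc j) \<noteq> 0"
      by (rule tendsto_imp_eventually_ne[OF LIMSEQ_Suc[OF assms(1)]])
    then show ?thesis
      by eventually_elim (use unsel in auto)
  qed simp
  ultimately show ?thesis
    by eventually_elim simp
qed

text \<open>With \<open>S j\<close> possibly alternating forever, the half step still converges: infinitely many
  selected indices force \<open>d\<^sub>0 = 0\<close>, so that the gradient step tends to \<open>u\<^sub>0\<close>, and infinitely many
  unselected ones force \<open>u\<^sub>0 = 0\<close>, the value assigned there.\<close>

lemma gradient_step_tendsto: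
  fixes u d :: "nat \<Rightarrow> real"
  assumes "u \<longlonglongrightarrow> u\<^sub>0" and "d \<longlonglongrightarrow> d\<^sub>0"
    and "\<forall>\<^sub>F j in sequentially. if S j then d\<^sub>0 = 0 else u\<^sub>0 = 0"
  shows "(\<lambda>j. if S j then u j - \<gamma> * d j else 0) \<longlonglongrightarrow> u\<^sub>0"
proof (cases "d\<^sub>0 = 0")
  case True
  have lim: "(\<lambda>j. u j - \<gamma> * d j) \<longlonglongrightarrow> u\<^sub>0"
    using tendsto_diff[OF assms(1) tendsto_mult_left[OF assms(2), of \<gamma>]] True by simp
  show ?thesis
  proof (cases "u\<^sub>0 = 0")
    case True
    then have "(\<lambda>j. u j - \<gamma> * d j) \<longlonglongrightarrow> 0"
      using lim by simp
    then show ?thesis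
      unfolding True by (rule Lim_null_comparison[OF _ tendsto_norm_zero, rotated]) auto
  next
    case False
    with assms(3) have "\<forall>\<^sub>F j in sequentially. S j"
      by (auto elim: eventually_mono split: if_splits)
    then have "\<forall>\<^sub>F j in sequentially. u j - \<gamma> * d j = (if S j then u j - \<gamma> * d j else 0)"
      by eventually_elim simp
    then show ?thesis
      by (rule Lim_transform_eventually[OF lim])
  qed
next
  case False
  then have "\<forall>\<^sub>F j in sequentially. \<not> S j \<and> u\<^sub>0 = 0"
    using assms(3) by (auto elim: eventually_mono split: if_splits)
  then show ?thesis
    by (intro tendsto_eventually) (auto elim: eventually_mono)
qed

section \<open>Finite termination\<close>

theorem theorem9:
  fixes s :: nat and lam \<rho> \<mu> \<alpha> \<beta> lg \<sigma>g :: real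
    and b :: "'n::finite" and x :: "real ^ 'n ^ 'm::finite" and y :: "real ^ 'm"
    and A :: "real ^ 'n ^ 'm"
    and z :: "real ^ 'm" and wk :: "real ^ 'n"
    and g :: "(real ^ 'n) \<times> (real ^ 'm) \<Rightarrow> real"
    and u uh ut :: "nat \<Rightarrow> (real ^ 'n) \<times> (real ^ 'm)"
    and T :: "nat \<Rightarrow> 'n set" and \<Gamma> :: "nat \<Rightarrow> 'm set"
    and uhat :: "(real ^ 'n) \<times> (real ^ 'm)"
  assumes "1 \<le> s" and "s \<le> CARD('n)"
    and "lam > 0" and "\<rho> > 0" and "\<mu> > 0"
    and "\<And>i. y $ i \<in> {1, -1}"
    and A_def: "A = data_matrix b x y"
    and g_def: "g = sub_g A \<rho> \<mu> z wk"
    and "lg > 0" and "lg-lipschitz_on UNIV (grad g)"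
    and "\<sigma>g > 0" and "strongly_convex \<sigma>g g"
    and "\<alpha> \<in> {0<..<1 / lg}" and "\<beta> \<in> {0<..<1 / lg}"
    and "pgn_run g s lam \<alpha> \<beta> \<sigma>g u T \<Gamma> uh ut"
    and "u \<longlonglongrightarrow> uhat"
    and "P_stationary g s lam \<alpha> \<beta> uhat"
    and "\<And>i. snd uhat $ i + snd (grad g uhat) $ i \<noteq> 0"
  shows "\<exists>jk. (\<forall>j\<ge>jk. newton_accepted g s lam \<sigma>g (uh j) (ut j) \<and> u (Suc j) = ut j) \<and>
    (\<exists>C. \<forall>j\<ge>jk. norm (u (Suc j) - uhat) \<le> C * (norm (u j - uhat))\<^sup>2)"
proof -
  have \<alpha>: "\<alpha> > 0" and \<beta>: "\<beta> > 0"
    using assms(13,14) by auto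
  obtain L c where Q: "quadratic g L c"
    using quadratic_sub_g unfolding g_def by blast
  interpret quadratic g L c by (rule Q)
  have step: "pgn_step g s lam \<alpha> \<beta> \<sigma>g (u j) (T j) (\<Gamma> j) (uh j) (ut j) (u (Suc j))" for j
    using assms(15) by (simp add: pgn_run_def)
  have uh: "uh j = (vec_restrict (T j) (fst (u j) - \<alpha> *\<^sub>R fst (grad g (u j))),
      vec_restrict (\<Gamma> j) (snd (u j) - \<beta> *\<^sub>R snd (grad g (u j))))"
    and card_T: "card (T j) = s"
    and newton: "newton_solution g (T j) (\<Gamma> j) (uh j) (ut j)"
    and next_u: "u (Suc j) = (if newton_accepted g s lam \<sigma>g (uh j) (ut j) then ut j else uh j)" for j
    using step[of j] unfolding pgn_step_def Let_def top_index_sets_def mem_Collect_eq by blast+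
  have uh_fst: "fst (uh j) $ i = (if i \<in> T j then fst (u j) $ i - \<alpha> * fst (grad g (u j)) $ i else 0)"
    and uh_snd: "snd (uh j) $ k = (if k \<in> \<Gamma> j then snd (u j) $ k - \<beta> * snd (grad g (u j)) $ k else 0)"
    for i j k
    by (simp_all add: uh vec_restrict_def)
  have uh_space: "uh j \<in> coord_space (T j) (\<Gamma> j)" for j
    by (simp add: coord_space_def uh_fst uh_snd)
  have ut_space: "ut j \<in> coord_space (T j) (\<Gamma> j)" for j
    by (rule newton_solution_coord_space[OF newton])
  note ut_grad = newton_solution_grad_zero[OF Q newton uh_space]

  have u_lim: "u \<longlonglongrightarrow> uhat" by fact
  have grad_lim: "(\<lambda>j. grad g (u j)) \<longlonglongrightarrow> grad g uhat"
    unfolding grad_eq by (intro tendsto_intros bounded_linear.tendsto[OF bounded_linear_L] u_lim)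
  note lims = tendsto_vec_nth[OF tendsto_fst[OF u_lim]] tendsto_vec_nth[OF tendsto_fst[OF grad_lim]]
    tendsto_vec_nth[OF tendsto_snd[OF u_lim]] tendsto_vec_nth[OF tendsto_snd[OF grad_lim]]
  have ident_w: "\<forall>\<^sub>F j in sequentially.
      if i \<in> T j then fst (grad g uhat) $ i = 0 else fst uhat $ i = 0" for i
    by (rule selection_identified[OF lims(1,2) \<alpha>])
      (use ut_space ut_grad(1) in \<open>auto simp: next_u uh_fst coord_space_def\<close>)
  have ident_\<xi>: "\<forall>\<^sub>F j in sequentially.
      if i \<in> \<Gamma> j then snd (grad g uhat) $ i = 0 else snd uhat $ i = 0" for i
    by (rule selection_identified[OF lims(3,4) \<beta>])
      (use ut_space ut_grad(2) in \<open>auto simp: next_u uh_snd coord_space_def\<close>)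

  have all_w: "\<forall>\<^sub>F j in sequentially. \<forall>i.
      if i \<in> T j then fst (grad g uhat) $ i = 0 else fst uhat $ i = 0"
    by (rule eventually_all_finite[OF ident_w])
  have all_\<xi>: "\<forall>\<^sub>F j in sequentially. \<forall>i.
      if i \<in> \<Gamma> j then snd (grad g uhat) $ i = 0 else snd uhat $ i = 0"
    by (rule eventually_all_finite[OF ident_\<xi>])

  have "(\<lambda>j. snd (uh j)) \<longlonglongrightarrow> snd uhat"
    by (rule vec_tendstoI) (simp only: uh_snd gradient_step_tendsto[OF lims(3,4) ident_\<xi>])
  then have loss: "\<forall>\<^sub>F j in sequentially. step_loss (snd uhat) \<le> step_loss (snd (uh j))"
    by (rule step_loss_lsc)

  have "\<forall>\<^sub>F j in sequentially. newton_accepted g s lam \<sigma>g (uh j) (ut j) \<and> ut j = uhat"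
    using all_w all_\<xi> loss
  proof eventually_elim
    case (elim j)
    have uhat_space: "uhat \<in> coord_space (T j) (\<Gamma> j)"
      using elim(1,2) by (auto simp: coord_space_def)
    have uhat_grad: "\<And>i. i \<in> T j \<Longrightarrow> fst (grad g uhat) $ i = 0"
      "\<And>i. i \<in> \<Gamma> j \<Longrightarrow> snd (grad g uhat) $ i = 0"
      using elim(1,2) by metis+
    have ut: "ut j = uhat"
      by (rule coord_space_critical_unique[OF Q assms(12,11) ut_space ut_grad uhat_space uhat_grad])
    have "g uhat + \<sigma>g / 2 * (norm (uh j - uhat))\<^sup>2 \<le> g (uh j)"
      by (rule coord_space_quadratic_growth[OF Q assms(12) uhat_space uhat_grad uh_space])
    moreover have "lam * step_loss (snd uhat) \<le> lam * step_loss (snd (uh j))"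
      using elim(3) \<open>lam > 0\<close> by simp
    moreover have "\<sigma>g / 4 * (norm (uh j - uhat))\<^sup>2 \<le> \<sigma>g / 2 * (norm (uh j - uhat))\<^sup>2"
      using \<open>\<sigma>g > 0\<close> by (intro mult_right_mono) auto
    moreover have "fst (uh j) \<in> sparse_set s" "fst uhat \<in> sparse_set s"
      using coord_space_sparse card_T uh_space uhat_space by blast+
    ultimately show ?case
      by (simp add: ut newton_accepted_def obj_def indicator_ext_def)
  qed
  then obtain jk where jk: "\<And>j. j \<ge> jk \<Longrightarrow> newton_accepted g s lam \<sigma>g (uh j) (ut j)"
      "\<And>j. j \<ge> jk \<Longrightarrow> ut j = uhat"
    unfolding eventually_sequentially by blast
  have exact: "u (Suc j) = ut j" "u (Suc j) = uhat" if "j \<ge> jk" for j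
    using jk[OF that] by (simp_all add: next_u)
  have "\<forall>j\<ge>jk. newton_accepted g s lam \<sigma>g (uh j) (ut j) \<and> u (Suc j) = ut j"
    using jk(1) exact(1) by blast
  \<comment> \<open>The constant is \<open>0\<close>, since the iterates reach the limit exactly.\<close>
  moreover have "\<forall>j\<ge>jk. norm (u (Suc j) - uhat) \<le> 0 * (norm (u j - uhat))\<^sup>2"
    by (simp add: exact(2))
  ultimately show ?thesis
    by blast
qed

end
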